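(* Let $a_n^{(2)}$ denote the number of $n$-step self-avoiding walks starting at $(0,0)$ and confined to the strip $\{0,1\} \times \mathbb{Z}$. Then $a_0^{(2)} = 1$, $a_1^{(2)} = 3$, and for all $n > 1$, $$a_n^{(2)} = 8 F_n - \frac{n}{2}\bigl(1 + (-1)^n\bigr) - 2\bigl(1 - (-1)^n\bigr),$$ where $F_n$ denotes the $n$-th Fibonacci number.
   Context: A self-avoiding walk with $n$ steps in the square lattice $\mathbb{Z}^2$ is a sequence of pairwise distinct lattice points $(x_0,y_0)=(0,0), (x_1,y_1), \dots, (x_n,y_n)$ such that for each $i$, $(x_{i+1},y_{i+1})$ is one of the four nearest neighbors $(x_i\pm 1, y_i)$, $(x_i, y_i \pm 1)$ of $(x_i,y_i)$. The walk is confined to the strip $\{0,1\}\times\mathbb{Z}$ if every $x_i \in \{0,1\}$. The Fibonacci numbers are given by $F_0=0$, $F_1=1$, $F_{n}=F_{n-1}+F_{n-2}$. *)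

theory Defs
  imports "HOL-Number_Theory.Fib"
begin

definition neighbours :: "int \<times> int \<Rightarrow> (int \<times> int) set" where
  "neighbours p = (case p of (x, y) \<Rightarrow> {(x + 1, y), (x - 1, y), (x, y + 1), (x, y - 1)})"

text \<open>A walk with \<open>n\<close> steps is the list of its \<open>n + 1\<close> successive lattice points.\<close>

definition self_avoiding_walks :: "nat \<Rightarrow> (int \<times> int) list set" where
  "self_avoiding_walks n =
     {w. length w = n + 1 \<and> w ! 0 = (0, 0) \<and> distinct w \<and>
         (\<forall>i<n. w ! (i + 1) \<in> neighbours (w ! i))}"

definition strip :: "(int \<times> int) set" where
  "strip = {0, 1} \<times> UNIV"

definition num_strip_walks :: "nat \<Rightarrow> nat" where
  "num_strip_walks n = card {w \<in> self_avoiding_walks n. set w \<subseteq> strip}"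

end

(* A sidestep leaves only two options: carry on in the current vertical direction, never to return,
   or turn back along the visited column. Turning back is forced from then on; it ends either at a
   wall of visited points or, once the row of the origin is passed, in an unvisited half-strip
   traversed in the opposite direction. So up to symmetry only two kinds of position need counting:
   the tip of a straight segment rising from a wall (behind_wall) or from the origin (straight).
   Strong induction on the number of remaining steps gives closed forms for both, for all segment
   lengths simultaneously, since a step straight on lengthens the segment. *)

theory Submission
  imports Defs
begin

section \<open>Counting the ways to continue a partial walk\<close>

text \<open>A partial walk affects its future only through its visited set \<open>V\<close> and its
  tip \<open>p\<close>. The list omits \<open>p\<close>, so its length is the number of steps still
  to be taken.\<close>

definition continuations ::
    "(int \<times> int) set \<Rightarrow> int \<times> int \<Rightarrow> nat \<Rightarrow> (int \<times> int) list set" where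
  "continuations V p n = {w. length w = n \<and> distinct w \<and> set w \<inter> V = {} \<and> set w \<subseteq> strip \<and>
     successively (\<lambda>a b. b \<in> neighbours a) (p # w)}"

definition num_continuations :: "(int \<times> int) set \<Rightarrow> int \<times> int \<Rightarrow> nat \<Rightarrow> nat" where
  "num_continuations V p n = card (continuations V p n)"

text \<open>The value 0 at visited points lets step counts be summed over all neighbours in the
  strip, whatever \<open>V\<close> is.\<close>

definition num_via :: "(int \<times> int) set \<Rightarrow> nat \<Rightarrow> int \<times> int \<Rightarrow> nat" where
  "num_via V n q = (if q \<in> V then 0 else num_continuations (insert q V) q n)"

lemma num_via_simps:
  "q \<in> V \<Longrightarrow> num_via V n q = 0"
  "q \<notin> V \<Longrightarrow> num_via V n q = num_continuations (insert q V) q n"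
  by (simp_all add: num_via_def)

lemma continuations_0: "continuations V p 0 = {[]}"
  by (auto simp: continuations_def)

lemma num_continuations_0 [simp]: "num_continuations V p 0 = 1"
  by (simp add: num_continuations_def continuations_0)

lemma continuations_Suc:
  "continuations V p (Suc n) =
     (\<Union>q\<in>neighbours p \<inter> strip - V. (#) q ` continuations (insert q V) q n)"
proof (rule set_eqI)
  fix w
  show "w \<in> continuations V p (Suc n) \<longleftrightarrow>
    w \<in> (\<Union>q\<in>neighbours p \<inter> strip - V. (#) q ` continuations (insert q V) q n)"
    by (cases w) (auto simp: continuations_def)
qed

lemma finite_neighbours: "finite (neighbours p)"
  by (cases p) (simp add: neighbours_def)

lemma finite_continuations: "finite (continuations V p n)"
  by (induction n arbitrary: V p) (auto simp: continuations_0 continuations_Suc finite_neighbours)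

lemma num_continuations_Suc:
  "num_continuations V p (Suc n) = (\<Sum>q\<in>neighbours p \<inter> strip. num_via V n q)"
proof -
  have "num_continuations V p (Suc n) =
    (\<Sum>q\<in>neighbours p \<inter> strip - V. card ((#) q ` continuations (insert q V) q n))"
    unfolding num_continuations_def continuations_Suc
    by (rule card_UN_disjoint) (auto simp: finite_neighbours finite_continuations)
  also have "\<dots> = (\<Sum>q\<in>neighbours p \<inter> strip - V. num_via V n q)"
    by (rule sum.cong) (auto simp: num_via_def num_continuations_def card_image)
  also have "\<dots> = (\<Sum>q\<in>neighbours p \<inter> strip. num_via V n q)"
    by (rule sum.mono_neutral_left) (auto simp: finite_neighbours num_via_def)
  finally show ?thesis .
qed

text \<open>The sign \<open>d\<close> is left open so that the two vertical terms can be read as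
  ahead and behind for either heading.\<close>

lemma num_continuations_step:
  fixes x y d :: int
  assumes "x \<in> {0, 1}" "d \<in> {1, -1}"
  shows "num_continuations V (x, y) (Suc n) =
    num_via V n (1 - x, y) + num_via V n (x, y + d) + num_via V n (x, y - d)"
proof -
  have "neighbours (x, y) \<inter> strip = {(1 - x, y), (x, y + d), (x, y - d)}"
    using assms by (auto simp: neighbours_def strip_def)
  then show ?thesis
    using assms by (auto simp: num_continuations_Suc)
qed

lemma num_strip_walks_eq_num_continuations:
  "num_strip_walks n = num_continuations {(0, 0)} (0, 0) n"
proof -
  have "{w \<in> self_avoiding_walks n. set w \<subseteq> strip} = (#) (0, 0) ` continuations {(0, 0)} (0, 0) n"
  proof (rule set_eqI)
    fix w :: "(int \<times> int) list"
    show "w \<in> {w \<in> self_avoiding_walks n. set w \<subseteq> strip} \<longleftrightarrow>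
      w \<in> (#) (0, 0) ` continuations {(0, 0)} (0, 0) n"
      by (cases w) (auto simp: self_avoiding_walks_def continuations_def strip_def
          successively_conv_nth)
  qed
  then show ?thesis
    by (simp add: num_strip_walks_def num_continuations_def card_image)
qed

section \<open>Straight runs with a wall behind\<close>

text \<open>Absorbs the dead-end branch into the closed form: a pocket of \<open>k\<close> free
  cells admits one forced walk of \<open>n\<close> steps if \<open>n \<le> k\<close>, and none
  otherwise.\<close>

lemma min_half_step:
  "min (int n) ((int n + int k) div 2) =
     min (int n - 1) ((int n + int k) div 2) + (if n \<le> k then 1 else 0)"
proof (cases "n \<le> k")
  case True
  then have "int n \<le> (int n + int k) div 2" by linarith
  then show ?thesis using True by simp
next
  case False
  then have "(int n + int k) div 2 \<le> int n - 1" by linarith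
  then show ?thesis using False by simp
qed

lemma half_step: "int (Suc n) div 2 = int n div 2 + (if even n then 0 else 1)"
  by presburger

text \<open>
  The walk has reached \<open>(x, y)\<close> heading in direction \<open>d\<close>. The other column is free ahead and
  for \<open>k\<close> rows back, where a turning walk gets stuck. Heights are compared after multiplication
  by \<open>d\<close>, which treats both directions at once.
\<close>

definition behind_wall :: "int \<Rightarrow> nat \<Rightarrow> (int \<times> int) set \<Rightarrow> int \<Rightarrow> int \<Rightarrow> bool" where
  "behind_wall d k V x y \<longleftrightarrow> x \<in> {0, 1} \<and> d \<in> {1, -1} \<and>
     (\<forall>z. d * y < d * z \<longrightarrow> (x, z) \<notin> V) \<and>
     (\<forall>z. d * y - int k - 1 \<le> d * z \<and> d * z \<le> d * y \<longrightarrow> (x, z) \<in> V) \<and>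
     (\<forall>z. d * y - int k \<le> d * z \<longrightarrow> (1 - x, z) \<notin> V) \<and>
     (1 - x, y - d * (int k + 1)) \<in> V"

text \<open>The point behind the tip and the whole column alongside are visited, so every step is
  forced until the \<open>k\<close> free cells ahead are used up.\<close>

lemma num_continuations_dead_end:
  assumes "x \<in> {0, 1}" "d \<in> {1, -1}" "(x, y - d) \<in> V"
    and "\<And>z. d * y \<le> d * z \<Longrightarrow> d * z \<le> d * y + int k \<Longrightarrow> (1 - x, z) \<in> V"
    and "\<And>z. d * y < d * z \<Longrightarrow> d * z \<le> d * y + int k \<Longrightarrow> (x, z) \<notin> V"
    and "(x, y + d * (int k + 1)) \<in> V"
    and "(x, y) \<in> V"
  shows "num_continuations V (x, y) n = (if n \<le> k then 1 else 0)"
  using assms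
proof (induction n arbitrary: k V y)
  case (Suc n)
  have dd: "d * d = 1" using Suc.prems(2) by auto
  have *: "num_continuations V (x, y) (Suc n) = num_via V n (x, y + d)"
    using Suc.prems(3) Suc.prems(4)[of y] by (simp add: num_continuations_step[OF Suc.prems(1,2)] num_via_simps)
  show ?case
  proof (cases k)
    case 0
    then have "(x, y + d) \<in> V" using Suc.prems(6) by simp
    then show ?thesis using * 0 by (simp add: num_via_simps)
  next
    case (Suc k')
    have "(x, y + d) \<notin> V" using Suc.prems(5)[of "y + d"] Suc dd by (simp add: algebra_simps)
    moreover have "num_continuations (insert (x, y + d) V) (x, y + d) n = (if n \<le> k' then 1 else 0)"
      using Suc.prems(2)
      by (intro Suc.IH; insert Suc.prems Suc; auto simp: algebra_simps)
    ultimately show ?thesis using * Suc by (simp add: num_via_simps)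
  qed
qed simp

text \<open>For \<open>n \<ge> 1\<close> the \<open>min\<close> term counts the walks that turn back
  after their first sidestep: with \<open>i\<close> steps forward before it, the
  \<open>n - 1 - i \<ge> 1\<close> steps back fit iff \<open>n - 1 - i \<le> k + i\<close>. The
  other terms count the remaining walks and are independent of \<open>k\<close>.\<close>

lemma num_continuations_behind_wall:
  assumes "behind_wall d k V x y"
  shows "int (num_continuations V (x, y) n) =
    2 * int (fib (n + 1)) - int n div 2 + min (int n - 1) ((int n + int k - 1) div 2)"
  using assms
proof (induction n arbitrary: k V x y rule: less_induct)
  case (less n)
  have x: "x \<in> {0, 1}" and d: "d \<in> {1, -1}" using less.prems by (auto simp: behind_wall_def)
  have x': "1 - x \<in> {0, 1}" using x by auto
  show ?case
  proof (cases n)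
    case (Suc m)
    define W where "W = insert (1 - x, y) V"
    have "(x, y + d) \<notin> V" "(x, y - d) \<in> V" "(1 - x, y) \<notin> V"
      using less.prems by (auto simp: behind_wall_def)
    then have step: "num_continuations V (x, y) n =
      num_continuations W (1 - x, y) m +
      num_continuations (insert (x, y + d) V) (x, y + d) m"
      by (simp add: Suc W_def num_continuations_step[OF x d] num_via_simps)
    \<comment> \<open>The wall stays in place: the tip moves one row away while \<open>k\<close>
      grows by one.\<close>
    have "y + d - d * (int (Suc k) + 1) = y - d * (int k + 1)"
      by (simp add: algebra_simps)
    then have "(1 - x, y + d - d * (int (Suc k) + 1)) \<in> V"
      using less.prems by (simp only: behind_wall_def)
    then have "behind_wall d (Suc k) (insert (x, y + d) V) x (y + d)"
      using less.prems by (auto simp: behind_wall_def)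
    from less.IH[OF _ this, of m]
    have forward: "int (num_continuations (insert (x, y + d) V) (x, y + d) m) =
      2 * int (fib (m + 1)) - int m div 2 + min (int m - 1) ((int m + int (Suc k) - 1) div 2)"
      using Suc by simp
    show ?thesis
    proof (cases m)
      case 0
      then show ?thesis using step forward Suc by simp
    next
      case (Suc l)
      have out: "(1 - x, y + d) \<notin> W" "(x, y) \<in> W"
        using less.prems by (auto simp: behind_wall_def W_def)
      \<comment> \<open>After sidestep and advance, the abandoned point \<open>(x, y)\<close> is
        itself the wall, hence \<open>k = 0\<close> in the new position.\<close>
      have "behind_wall d 0 (insert (1 - x, y + d) W) (1 - x) (y + d)"
        using less.prems by (auto simp: behind_wall_def W_def)
      from less.IH[OF _ this, of l]
      have up: "int (num_via W l (1 - x, y + d)) =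
        2 * int (fib (l + 1)) - int l div 2 + min (int l - 1) ((int l - 1) div 2)"
        using out \<open>n = Suc m\<close> Suc by (simp add: num_via_simps)
      have "min (int l - 1) ((int l - 1) div 2) = (int l - 1) div 2" by linarith
      moreover have "(int l - 1) div 2 = int l div 2 - (if even m then 0 else 1)"
        using Suc by presburger
      ultimately have up': "int (num_via W l (1 - x, y + d)) =
        2 * int (fib (l + 1)) - (if even m then 0 else 1)"
        using up by simp
      \<comment> \<open>For \<open>k = 0\<close> the point below is the wall. Otherwise the first
        step back uses one cell of the pocket, which leaves \<open>k - 1\<close>.\<close>
      have down: "num_via W l (1 - x, y - d) = (if m \<le> k then 1 else 0)"
      proof (cases k)
        case 0
        then have "(1 - x, y - d) \<in> W"
          using less.prems by (auto simp: behind_wall_def W_def)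
        then show ?thesis using 0 Suc by (simp add: num_via_simps)
      next
        case (Suc k')
        have "(1 - x, y - d) \<notin> W"
          using less.prems Suc by (auto simp: behind_wall_def W_def)
        moreover have "num_continuations (insert (1 - x, y - d) W) (1 - x, y - d) l =
          (if l \<le> k' then 1 else 0)"
          by (rule num_continuations_dead_end[where d = "- d"];
              use less.prems Suc in \<open>auto simp: behind_wall_def W_def algebra_simps\<close>)
        ultimately show ?thesis using \<open>m = Suc l\<close> Suc by (simp add: num_via_simps)
      qed
      have "num_continuations W (1 - x, y) m =
        num_via W l (1 - x, y + d) + num_via W l (1 - x, y - d)"
        using out by (simp add: Suc num_continuations_step[OF x' d] num_via_simps)
      then have "int (num_continuations V (x, y) n) =
        int (num_via W l (1 - x, y + d)) + int (num_via W l (1 - x, y - d)) +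
        int (num_continuations (insert (x, y + d) V) (x, y + d) m)"
        using step by simp
      \<comment> \<open>Grouped for \<open>half_step\<close> and \<open>min_half_step\<close>: the
        parity defect of \<open>up'\<close> turns \<open>int m div 2\<close> into
        \<open>int (Suc m) div 2\<close>, and the dead-end count completes the \<open>min\<close>
        term.\<close>
      also have "\<dots> = 2 * int (fib (l + 1)) + 2 * int (fib (m + 1)) -
        (int m div 2 + (if even m then 0 else 1)) +
        (min (int m - 1) ((int m + int k) div 2) + (if m \<le> k then 1 else 0))"
        unfolding up' down forward by simp
      also have "\<dots> = 2 * int (fib (n + 1)) - int (Suc m) div 2 +
          min (int m) ((int m + int k) div 2)"
        unfolding min_half_step half_step by (simp add: \<open>n = Suc m\<close> Suc)
      finally show ?thesis using \<open>n = Suc m\<close> by simp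
    qed
  qed simp
qed

lemma num_continuations_behind_wall_0:
  assumes "behind_wall d 0 V x y"
  shows "int (num_continuations V (x, y) n) = 2 * int (fib (n + 1)) - (if even n then 1 else 0)"
proof -
  have "min (int n - 1) ((int n - 1) div 2) = (int n - 1) div 2" by linarith
  moreover have "(int n - 1) div 2 - int n div 2 = - (if even n then 1 else 0)" by presburger
  ultimately show ?thesis using num_continuations_behind_wall[OF assms, of n] by simp
qed

section \<open>Straight runs from the origin\<close>

text \<open>The first \<open>k\<close> steps are forced alongside the visited column. One more step
  passes its end, which then acts as a wall directly behind, with \<open>n - k - 1\<close> steps
  left.\<close>

lemma num_continuations_corridor:
  assumes "x \<in> {0, 1}" "d \<in> {1, -1}" "(x, y - d) \<in> V"
    and "\<And>z. d * y \<le> d * z \<Longrightarrow> d * z \<le> d * y + int k \<Longrightarrow> (1 - x, z) \<in> V"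
    and "\<And>z. d * y < d * z \<Longrightarrow> (x, z) \<notin> V"
    and "\<And>z. d * y + int k < d * z \<Longrightarrow> (1 - x, z) \<notin> V"
    and "(x, y) \<in> V"
  shows "int (num_continuations V (x, y) n) =
    (if n \<le> k then 1 else 2 * int (fib (n - k)) - (if even (n - k) then 0 else 1))"
  using assms
proof (induction n arbitrary: k V y)
  case (Suc n)
  have "(x, y + d) \<notin> V" using Suc.prems(2) Suc.prems(5)[of "y + d"] by auto
  then have *: "num_continuations V (x, y) (Suc n) =
      num_continuations (insert (x, y + d) V) (x, y + d) n"
    using Suc.prems(3) Suc.prems(4)[of y]
    by (simp add: num_continuations_step[OF Suc.prems(1,2)] num_via_simps)
  show ?case
  proof (cases k)
    case 0
    have "\<forall>z. d * y \<le> d * z \<and> d * z \<le> d * y \<longrightarrow> (x, z) \<in> V"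
      using Suc.prems(2,7) by auto
    then have "behind_wall d 0 (insert (x, y + d) V) x (y + d)"
      using Suc.prems 0 by (auto simp: behind_wall_def)
    from num_continuations_behind_wall_0[OF this, of n] show ?thesis using * 0 by simp
  next
    case (Suc k')
    have "int (num_continuations (insert (x, y + d) V) (x, y + d) n) =
      (if n \<le> k' then 1 else 2 * int (fib (n - k')) - (if even (n - k') then 0 else 1))"
      using Suc.prems(2)
      by (intro Suc.IH; insert Suc.prems Suc; auto)
    then show ?thesis using * Suc by simp
  qed
qed simp

text \<open>The parameter \<open>j\<close> counts steps, so the segment has \<open>j + 1\<close>
  points and \<open>(x, y)\<close> is its last.\<close>

definition straight :: "int \<Rightarrow> nat \<Rightarrow> int \<Rightarrow> int \<Rightarrow> (int \<times> int) set" where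
  "straight d j x y = {x} \<times> {z. d * y - int j \<le> d * z \<and> d * z \<le> d * y}"

text \<open>The terms without \<open>n - j\<close> are those of
  \<open>num_continuations_behind_wall\<close> with \<open>k = j\<close>: they count the walks that
  never pass back beyond the row where the segment starts. The terms in \<open>n - j\<close> count
  those that do. Since \<open>j \<ge> 1\<close>, the point behind the tip is visited.\<close>

lemma num_continuations_straight:
  assumes "x \<in> {0, 1}" "d \<in> {1, -1}" "j \<ge> 1"
  shows "int (num_continuations (straight d j x y) (x, y) n) =
    2 * int (fib (n + 1)) - int n div 2 + min (int n - 1) ((int n + int j - 1) div 2) +
    2 * int (fib (n - j)) - (if even (n - j) then int (n - j) div 2 else 2)"
  using assms
proof (induction n arbitrary: j y rule: less_induct)
  case (less n)
  note x = less.prems(1) and d = less.prems(2)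
  have x': "1 - x \<in> {0, 1}" using x by auto
  define V where "V = straight d j x y"
  show ?case
  proof (cases n)
    case (Suc m)
    define W where "W = insert (1 - x, y) V"
    have "(x, y + d) \<notin> V" "(x, y - d) \<in> V" "(1 - x, y) \<notin> V"
      using less.prems by (auto simp: V_def straight_def)
    then have step: "num_continuations V (x, y) n =
      num_continuations W (1 - x, y) m +
      num_continuations (insert (x, y + d) V) (x, y + d) m"
      by (simp add: Suc W_def num_continuations_step[OF x d] num_via_simps)
    have "insert (x, y + d) V = straight d (Suc j) x (y + d)"
      using less.prems by (auto simp: V_def straight_def)
    then have forward: "int (num_continuations (insert (x, y + d) V) (x, y + d) m) =
      2 * int (fib (m + 1)) - int m div 2 + min (int m - 1) ((int m + int (Suc j) - 1) div 2) +
      2 * int (fib (m - Suc j)) - (if even (m - Suc j) then int (m - Suc j) div 2 else 2)"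
      using less.IH[of m "Suc j" "y + d"] x d Suc by simp
    show ?thesis
    proof (cases m)
      case 0
      then show ?thesis using step forward Suc less.prems by (simp add: V_def)
    next
      case (Suc l)
      have out: "(1 - x, y + d) \<notin> W" "(1 - x, y - d) \<notin> W" "(x, y) \<in> W"
        using less.prems by (auto simp: V_def straight_def W_def)
      have "behind_wall d 0 (insert (1 - x, y + d) W) (1 - x) (y + d)"
        using less.prems by (auto simp: behind_wall_def V_def straight_def W_def)
      from num_continuations_behind_wall_0[OF this, of l]
      have up: "int (num_via W l (1 - x, y + d)) =
        2 * int (fib (l + 1)) - (if even l then 1 else 0)"
        using out by (simp add: num_via_simps)
      \<comment> \<open>Turning back uses one of the \<open>j\<close> rows below the tip;
        \<open>k\<close> rows of corridor remain.\<close>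
      obtain k where k: "j = Suc k" using less.prems(3) by (cases j) auto
      have "int (num_continuations (insert (1 - x, y - d) W) (1 - x, y - d) l) =
        (if l \<le> k then 1 else 2 * int (fib (l - k)) - (if even (l - k) then 0 else 1))"
        by (rule num_continuations_corridor[where d = "- d"];
            use less.prems k in \<open>auto simp: V_def straight_def W_def\<close>)
      then have down: "int (num_via W l (1 - x, y - d)) =
        (if l \<le> k then 1 else 2 * int (fib (l - k)) - (if even (l - k) then 0 else 1))"
        using out by (simp add: num_via_simps)
      have "num_continuations W (1 - x, y) m =
        num_via W l (1 - x, y + d) + num_via W l (1 - x, y - d)"
        using out by (simp add: Suc num_continuations_step[OF x' d] num_via_simps)
      then have "int (num_continuations V (x, y) n) =
        int (num_via W l (1 - x, y + d)) + int (num_via W l (1 - x, y - d)) +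
        int (num_continuations (insert (x, y + d) V) (x, y + d) m)"
        using step by simp
      also have "\<dots> = 2 * int (fib (l + 1)) + 2 * int (fib (m + 1)) -
        (int m div 2 + (if even m then 0 else 1)) +
        (min (int m - 1) ((int m + int j) div 2) + (if m \<le> j then 1 else 0)) +
        2 * int (fib (n - j)) - (if even (n - j) then int (n - j) div 2 else 2)"
      \<comment> \<open>If the walk ends inside the corridor, \<open>n - j \<le> 1\<close> and the
        terms in \<open>n - j\<close> vanish, as do those in the truncated \<open>m - Suc j\<close>.
        Otherwise the Fibonacci indices are \<open>t\<close>, \<open>t + 1\<close> and
        \<open>t + 2\<close>, and the recurrence merges them.\<close>
      proof (cases "l \<le> k")
        case True
        then show ?thesis
          unfolding up down forward using \<open>n = Suc m\<close> Suc k by (cases "l = k") auto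
      next
        case False
        then obtain t where t: "l = Suc (k + t)" by (metis less_imp_Suc_add not_le)
        have "n - j = t + 2" "l - k = t + 1" "m - Suc j = t"
          using \<open>n = Suc m\<close> Suc k t by simp_all
        then show ?thesis
          unfolding up down forward using Suc k t False by simp
      qed
      also have "\<dots> = 2 * int (fib (n + 1)) - int (Suc m) div 2 +
          min (int m) ((int m + int j) div 2) +
          2 * int (fib (n - j)) - (if even (n - j) then int (n - j) div 2 else 2)"
        unfolding min_half_step half_step by (simp add: \<open>n = Suc m\<close> Suc)
      finally show ?thesis using \<open>n = Suc m\<close> by (simp add: V_def)
    qed
  qed simp
qed

section \<open>The first steps and the total count\<close>

lemma num_strip_walks_0: "num_strip_walks 0 = 1"
  by (simp add: num_strip_walks_eq_num_continuations)

lemma num_strip_walks_1: "num_strip_walks 1 = 3"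
  using num_continuations_step[of 0 1 "{(0, 0)}" 0 0]
  by (simp add: num_strip_walks_eq_num_continuations num_via_simps)

text \<open>A sideways first step leads by either vertical step to a wall position with
  \<open>k = 0\<close>; a vertical first step is a segment with \<open>j = 1\<close>. Doubling by
  reflection, the Fibonacci terms are \<open>4 * fib n + 4 * fib (n + 1) + 4 * fib (n + 2)\<close>,
  that is \<open>8 * fib (n + 2)\<close>.\<close>

lemma num_strip_walks_Suc_Suc:
  "int (num_strip_walks (n + 2)) =
     8 * int (fib (n + 2)) - (if even n then int n + 2 else 4)"
proof -
  define V :: "(int \<times> int) set" where "V = {(0, 0), (1, 0)}"
  have "int (num_continuations (insert (1, d) V) (1, d) n) =
      2 * int (fib (n + 1)) - (if even n then 1 else 0)" if "d \<in> {1, -1}" for d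
    using that
    by (intro num_continuations_behind_wall_0[where d = d]) (auto simp: V_def behind_wall_def)
  then have "int (num_continuations V (1, 0) (Suc n)) =
      2 * (2 * int (fib (n + 1)) - (if even n then 1 else 0))"
    using num_continuations_step[of 1 1 V 0 n] by (simp add: V_def num_via_simps)
  moreover have "{(0, d), (0, 0)} = straight d 1 0 d" if "d \<in> {1, -1}" for d
    using that by (auto simp: straight_def)
  then have "int (num_continuations {(0, d), (0, 0)} (0, d) (Suc n)) =
      2 * int (fib (n + 2)) - int (Suc n) div 2 + min (int n) (int (Suc n) div 2) +
      2 * int (fib n) - (if even n then int n div 2 else 2)"
    if "d \<in> {1, -1}" for d
    using num_continuations_straight[of 0 d 1 d "Suc n"] that by auto
  moreover have "num_strip_walks (n + 2) = num_continuations V (1, 0) (Suc n) +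
      num_continuations {(0, 1), (0, 0)} (0, 1) (Suc n) +
      num_continuations {(0, -1), (0, 0)} (0, -1) (Suc n)"
    using num_continuations_step[of 0 1 "{(0, 0)}" 0 "Suc n"]
    by (simp add: num_strip_walks_eq_num_continuations num_via_simps V_def insert_commute)
  moreover have "min (int n) (int (Suc n) div 2) = int (Suc n) div 2" by linarith
  ultimately show ?thesis by (simp split: if_splits; presburger)
qed

theorem mainTheorem1:
  shows "num_strip_walks 0 = 1 \<and> num_strip_walks 1 = 3 \<and>
    (\<forall>n::nat. n > 1 \<longrightarrow>
      real (num_strip_walks n) =
        8 * real (fib n) - real n / 2 * (1 + (- 1) ^ n) - 2 * (1 - (- 1) ^ n))"
proof (intro conjI allI impI)
  fix n :: nat
  assume "n > 1"
  then obtain m where m: "n = m + 2" by (metis add_2_eq_Suc' less_iff_Suc_add One_nat_def add_Suc)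
  have "real_of_int (int (num_strip_walks n)) =
      real_of_int (8 * int (fib n) - (if even m then int m + 2 else 4))"
    unfolding m num_strip_walks_Suc_Suc ..
  then show "real (num_strip_walks n) =
      8 * real (fib n) - real n / 2 * (1 + (- 1) ^ n) - 2 * (1 - (- 1) ^ n)"
    by (cases "even m") (simp_all add: m field_simps)
qed (fact num_strip_walks_0 num_strip_walks_1)+

end
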